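(* There exists an ethical social welfare order $\precsim$ on $l_{\infty}$ which satisfies anonymity, strong monotonicity, strong distributive fairness semiconvexity and $\tau_{d^s_{\precsim}}$-continuity and, thus, lower $\tau_{d_{\precsim}}$-continuity.
   Context: $l_{\infty}$ is the set of bounded real sequences $x=(x_n)_{n\in\mathbb{N}}$. A preorder is a reflexive transitive relation $\precsim$; $x\sim y$ means $x\precsim y$ and $y\precsim x$; $x\prec y$ means $x\precsim y$ and not $y\precsim x$. A finite permutation is a bijection $\pi:\mathbb{N}\to\mathbb{N}$ for which there is $t_0$ with $\pi(t)=t$ for all $t>t_0$; $\Pi_\infty$ is the set of all of them, and $\pi(x)=(x_{\pi(n)})_{n\in\mathbb{N}}$. Axioms for a preorder $\precsim$ on $l_\infty$. Anonymity: $x\sim\pi(x)$ for all $x\in l_\infty$, $\pi\in\Pi_\infty$. Strong distributive fairness semiconvexity: for all $x\in l_\infty$, $\pi\in\Pi_\infty$ with $x\neq\pi(x)$, one has $x\prec sx+(1-s)\pi(x)$ and $\pi(x)\prec sx+(1-s)\pi(x)$ for all $s\in(0,1)$. Strong monotonicity: $x\prec y$ whenever $x_t\le y_t$ for all $t$ and $x\ne y$. An ethical social welfare order is a complete (total) preorder satisfying an equity requirement (such as anonymity) and a monotonicity requirement (such as strong monotonicity). A quasi-pseudo-metric on a set $Y$ is a function $d:Y\times Y\to[0,\infty)$ with $d(x,x)=0$ and $d(x,z)\le d(x,y)+d(y,z)$; it induces the topology $\tau_d$ with base the balls $B_d(x,\varepsilon)=\{y\in Y: d(x,y)<\varepsilon\}$,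 $\varepsilon>0$, and $d^s(x,y)=\max\{d(x,y),d(y,x)\}$. For a preorder $\precsim$, $d_{\precsim}$ is the quasi-pseudo-metric with $d_{\precsim}(x,y)=0$ if $x\precsim y$ and $d_{\precsim}(x,y)=1$ otherwise, and $d^s_{\precsim}=(d_{\precsim})^s$. For a topology $\tau$, $\precsim$ is lower $\tau$-continuous if $\{x: x\precsim y\}$ is $\tau$-closed for every $y$, and $\tau$-continuous if both $\{x: x\precsim y\}$ and $\{x: y\precsim x\}$ are $\tau$-closed for every $y$. *)

theory Defs
  imports "HOL-Analysis.Analysis"
begin

definition linf :: "(nat \<Rightarrow> real) set" where
  "linf = {x. bounded (range x)}"

text \<open>A preference is a set of pairs: \<open>(x, y) \<in> R\<close> means that \<open>y\<close> is at least as good as \<open>x\<close>.\<close>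

definition strictly_below :: "'a rel \<Rightarrow> 'a \<Rightarrow> 'a \<Rightarrow> bool" where
  "strictly_below R x y \<longleftrightarrow> (x, y) \<in> R \<and> (y, x) \<notin> R"

definition indifferent :: "'a rel \<Rightarrow> 'a \<Rightarrow> 'a \<Rightarrow> bool" where
  "indifferent R x y \<longleftrightarrow> (x, y) \<in> R \<and> (y, x) \<in> R"

definition finite_perms :: "(nat \<Rightarrow> nat) set" where
  "finite_perms = {\<pi>. bij \<pi> \<and> (\<exists>t0. \<forall>t>t0. \<pi> t = t)}"

definition anonymity :: "(nat \<Rightarrow> real) rel \<Rightarrow> bool" where
  "anonymity R \<longleftrightarrow> (\<forall>x\<in>linf. \<forall>\<pi>\<in>finite_perms. indifferent R x (x \<circ> \<pi>))"

definition strong_distributive_fairness_semiconvexity :: "(nat \<Rightarrow> real) rel \<Rightarrow> bool" where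
  "strong_distributive_fairness_semiconvexity R \<longleftrightarrow>
     (\<forall>x\<in>linf. \<forall>\<pi>\<in>finite_perms. x \<noteq> x \<circ> \<pi> \<longrightarrow>
        (\<forall>s\<in>{0<..<1}.
           strictly_below R x (\<lambda>n. s * x n + (1 - s) * (x \<circ> \<pi>) n) \<and>
           strictly_below R (x \<circ> \<pi>) (\<lambda>n. s * x n + (1 - s) * (x \<circ> \<pi>) n)))"

definition strong_monotonicity :: "(nat \<Rightarrow> real) rel \<Rightarrow> bool" where
  "strong_monotonicity R \<longleftrightarrow>
     (\<forall>x\<in>linf. \<forall>y\<in>linf. (\<forall>t. x t \<le> y t) \<and> x \<noteq> y \<longrightarrow> strictly_below R x y)"

text \<open>The equity requirement is anonymity, the monotonicity requirement strong monotonicity.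
  Together with reflexivity, \<open>total_on\<close> gives completeness.\<close>

definition ethical_social_welfare_order :: "(nat \<Rightarrow> real) rel \<Rightarrow> bool" where
  "ethical_social_welfare_order R \<longleftrightarrow>
     preorder_on linf R \<and> total_on linf R \<and> anonymity R \<and> strong_monotonicity R"

definition quasi_pseudo_metric_on :: "'a set \<Rightarrow> ('a \<Rightarrow> 'a \<Rightarrow> real) \<Rightarrow> bool" where
  "quasi_pseudo_metric_on Y d \<longleftrightarrow>
     (\<forall>x\<in>Y. \<forall>y\<in>Y. 0 \<le> d x y) \<and> (\<forall>x\<in>Y. d x x = 0) \<and>
     (\<forall>x\<in>Y. \<forall>y\<in>Y. \<forall>z\<in>Y. d x z \<le> d x y + d y z)"

definition qpm_ball :: "'a set \<Rightarrow> ('a \<Rightarrow> 'a \<Rightarrow> real) \<Rightarrow> 'a \<Rightarrow> real \<Rightarrow> 'a set" where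
  "qpm_ball Y d x e = {y \<in> Y. d x y < e}"

definition qpm_topology :: "'a set \<Rightarrow> ('a \<Rightarrow> 'a \<Rightarrow> real) \<Rightarrow> 'a topology" where
  "qpm_topology Y d =
     topology (arbitrary union_of (\<lambda>B. \<exists>x\<in>Y. \<exists>e>0. B = qpm_ball Y d x e))"

definition symmetrization :: "('a \<Rightarrow> 'a \<Rightarrow> real) \<Rightarrow> 'a \<Rightarrow> 'a \<Rightarrow> real" where
  "symmetrization d x y = max (d x y) (d y x)"

definition preorder_dist :: "'a rel \<Rightarrow> 'a \<Rightarrow> 'a \<Rightarrow> real" where
  "preorder_dist R x y = (if (x, y) \<in> R then 0 else 1)"

definition lower_continuous :: "'a set \<Rightarrow> 'a topology \<Rightarrow> 'a rel \<Rightarrow> bool" where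
  "lower_continuous Y T R \<longleftrightarrow> (\<forall>y\<in>Y. closedin T {x \<in> Y. (x, y) \<in> R})"

definition continuous_preorder :: "'a set \<Rightarrow> 'a topology \<Rightarrow> 'a rel \<Rightarrow> bool" where
  "continuous_preorder Y T R \<longleftrightarrow>
     (\<forall>y\<in>Y. closedin T {x \<in> Y. (x, y) \<in> R} \<and> closedin T {x \<in> Y. (y, x) \<in> R})"

text \<open>\<open>topology\<close> is only meaningful on families satisfying \<open>istopology\<close>; the lemmas below check
  that this is the case here.\<close>

lemma istopology_qpm:
  assumes "quasi_pseudo_metric_on Y d"
  shows "istopology (arbitrary union_of (\<lambda>B. \<exists>x\<in>Y. \<exists>e>0. B = qpm_ball Y d x e))"
    (is "istopology (arbitrary union_of ?P)")
proof -
  have "(arbitrary union_of ?P) (S \<inter> T)" if S: "?P S" and T: "?P T" for S T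
  proof -
    obtain a e where a: "a \<in> Y" "S = qpm_ball Y d a e" using S by blast
    obtain b f where b: "b \<in> Y" "T = qpm_ball Y d b f" using T by blast
    have "\<exists>U. ?P U \<and> z \<in> U \<and> U \<subseteq> S \<inter> T" if z: "z \<in> S \<inter> T" for z
    proof -
      define g where "g = min (e - d a z) (f - d b z)"
      have zY: "z \<in> Y" and "g > 0" using z a b by (auto simp: qpm_ball_def g_def)
      moreover have "z \<in> qpm_ball Y d z g"
        using assms zY \<open>g > 0\<close> by (auto simp: qpm_ball_def quasi_pseudo_metric_on_def)
      moreover have "qpm_ball Y d z g \<subseteq> S \<inter> T"
      proof
        fix w assume "w \<in> qpm_ball Y d z g"
        then have w: "w \<in> Y" "d z w < g" by (auto simp: qpm_ball_def)
        have "d a w \<le> d a z + d z w" "d b w \<le> d b z + d z w"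
          using assms a(1) b(1) w(1) zY unfolding quasi_pseudo_metric_on_def by blast+
        then show "w \<in> S \<inter> T" using w a b by (auto simp: qpm_ball_def g_def)
      qed
      ultimately show ?thesis by blast
    qed
    then show ?thesis unfolding arbitrary_union_of_alt by blast
  qed
  then show ?thesis by (simp add: istopology_base_eq)
qed

lemma openin_qpm_topology:
  assumes "quasi_pseudo_metric_on Y d"
  shows "openin (qpm_topology Y d) =
           arbitrary union_of (\<lambda>B. \<exists>x\<in>Y. \<exists>e>0. B = qpm_ball Y d x e)"
  unfolding qpm_topology_def using istopology_qpm[OF assms] by (simp add: topology_inverse')

lemma quasi_pseudo_metric_preorder_dist:
  assumes "preorder_on Y R"
  shows "quasi_pseudo_metric_on Y (preorder_dist R)"
  using assms
  by (auto simp: quasi_pseudo_metric_on_def preorder_dist_def preorder_on_def refl_on_def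
      dest: transD)

lemma quasi_pseudo_metric_symmetrization:
  assumes "quasi_pseudo_metric_on Y d"
  shows "quasi_pseudo_metric_on Y (symmetrization d)"
  unfolding quasi_pseudo_metric_on_def
proof (intro conjI ballI)
  fix x y z assume "x \<in> Y" "y \<in> Y" "z \<in> Y"
  then have "d x z \<le> d x y + d y z" "d z x \<le> d z y + d y x"
    using assms unfolding quasi_pseudo_metric_on_def by blast+
  then show "symmetrization d x z \<le> symmetrization d x y + symmetrization d y z"
    unfolding symmetrization_def by linarith
qed (use assms in \<open>auto simp: quasi_pseudo_metric_on_def symmetrization_def le_max_iff_disj\<close>)

end

theory Submission
  imports Defs
begin

text \<open>
  Fix a free ultrafilter on the natural numbers and let \<open>y\<close> be at least as good as \<open>x\<close> if, for almost
  all \<open>n\<close> in the sense of the ultrafilter, the utilitarian sum \<open>\<Sum>t<n. - exp (- x t)\<close> over the first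
  \<open>n\<close> generations of \<open>x\<close> is at most the one of \<open>y\<close>. The ultrafilter makes the order complete,
  monotonicity and strict concavity of the utility \<open>u \<mapsto> - exp (- u)\<close> give strong monotonicity and semiconvexity,
  and a finite permutation changes only finitely many partial sums. Continuity holds for every
  preorder: the balls of radius \<open>1\<close> of \<open>preorder_dist\<close> are upper contour sets, and those of its
  symmetrization are indifference classes.
\<close>

section \<open>Ultrafilters\<close>

text \<open>By Tychonoff's theorem, the evaluation maps \<open>\<lambda>P. P a\<close> have a cluster point \<open>p\<close> along \<open>F\<close>;
  the truth values it assigns to predicates define the ultrafilter.\<close>

lemma ultrafilter_exists:
  fixes F :: "'a filter"
  assumes "F \<noteq> bot"
  obtains U where "U \<noteq> bot" "U \<le> F" "\<And>P. eventually P U \<or> eventually (\<lambda>x. \<not> P x) U"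
proof -
  define e where "e = (\<lambda>a (P :: 'a \<Rightarrow> bool). P a)"
  have "compactin (product_topology (\<lambda>_. euclidean) UNIV)
          (Pi\<^sub>E UNIV (\<lambda>_::'a \<Rightarrow> bool. UNIV :: bool set))"
    unfolding compactin_PiE by (simp add: finite_imp_compact)
  then have "compact (UNIV :: (('a \<Rightarrow> bool) \<Rightarrow> bool) set)"
    by (simp add: euclidean_product_topology)
  moreover have "filtermap e F \<noteq> bot"
    using assms by (simp add: filtermap_bot_iff)
  ultimately obtain p where p: "inf (nhds p) (filtermap e F) \<noteq> bot"
    by (auto simp: compact_filter)
  \<comment> \<open>\<open>U\<close> keeps the points of \<open>F\<close> whose evaluation map is
    near \<open>p\<close>; it is proper because \<open>p\<close> is a cluster point.\<close>
  define U where "U = inf F (filtercomap e (nhds p))"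
  show thesis
  proof
    show "U \<noteq> bot"
    proof
      assume "U = bot"
      then have "eventually (\<lambda>_. False) U"
        by simp
      then obtain Q R where Q: "eventually Q F" and R: "eventually R (nhds p)"
        and QR: "\<And>a. Q a \<Longrightarrow> R (e a) \<Longrightarrow> False"
        unfolding U_def eventually_inf eventually_filtercomap by metis
      have "eventually (\<lambda>q. \<not> R q) (filtermap e F)"
        unfolding eventually_filtermap using Q by eventually_elim (use QR in blast)
      with R have "eventually (\<lambda>_. False) (inf (nhds p) (filtermap e F))"
        unfolding eventually_inf by metis
      with p show False
        by (simp add: trivial_limit_def)
    qed
    show "U \<le> F"
      by (simp add: U_def)
    fix P :: "'a \<Rightarrow> bool"
    \<comment> \<open>Evaluation at \<open>P\<close> is continuous into the discrete space
      \<open>bool\<close>, so every \<open>q\<close> close to \<open>p\<close> agrees with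
      \<open>p\<close> at \<open>P\<close>.\<close>
    have "continuous_on UNIV (\<lambda>q :: ('a \<Rightarrow> bool) \<Rightarrow> bool. q P)"
      by simp
    then have "open ((\<lambda>q :: ('a \<Rightarrow> bool) \<Rightarrow> bool. q P) -` {p P})"
      by (intro open_vimage open_discrete)
    then have "eventually (\<lambda>q. q P = p P) (nhds p)"
      unfolding eventually_nhds by (intro exI) auto
    then have "eventually (\<lambda>a. e a P = p P) U"
      unfolding U_def by (intro filter_leD[OF inf_le2]) (auto simp: eventually_filtercomap)
    then show "eventually P U \<or> eventually (\<lambda>x. \<not> P x) U"
      by (cases "p P") (simp_all add: e_def)
  qed
qed

section \<open>Continuity of preorders\<close>

text \<open>Reduces closedness to finding, around each point outside \<open>C\<close>, a ball that
  misses \<open>C\<close>. The balls form a base, and \<open>d x x = 0\<close> puts each point into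
  its own balls.\<close>

lemma closedin_qpm_topology:
  assumes "quasi_pseudo_metric_on Y d" "C \<subseteq> Y"
    and "\<And>x. x \<in> Y - C \<Longrightarrow> \<exists>e>0. qpm_ball Y d x e \<inter> C = {}"
  shows "closedin (qpm_topology Y d) C"
proof -
  have op: "openin (qpm_topology Y d) S"
    if S: "S \<subseteq> Y" "\<And>x. x \<in> S \<Longrightarrow> \<exists>e>0. qpm_ball Y d x e \<subseteq> S" for S
  proof -
    have "\<exists>B. (\<exists>x\<in>Y. \<exists>e>0. B = qpm_ball Y d x e) \<and> x \<in> B \<and> B \<subseteq> S" if x: "x \<in> S" for x
    proof -
      obtain e where "e > 0" "qpm_ball Y d x e \<subseteq> S"
        using S(2) x by blast
      moreover have "x \<in> Y" "x \<in> qpm_ball Y d x e"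
        using S(1) x \<open>e > 0\<close> assms(1) by (auto simp: qpm_ball_def quasi_pseudo_metric_on_def)
      ultimately show ?thesis
        by blast
    qed
    then show ?thesis
      unfolding openin_qpm_topology[OF assms(1)] arbitrary_union_of_alt by blast
  qed
  have "openin (qpm_topology Y d) Y"
    by (rule op) (auto simp: qpm_ball_def intro: exI[of _ 1])
  moreover have "topspace (qpm_topology Y d) \<subseteq> Y"
    unfolding topspace_def openin_qpm_topology[OF assms(1)] union_of_def
    by (auto simp: qpm_ball_def)
  ultimately have "topspace (qpm_topology Y d) = Y"
    by (meson openin_subset subset_antisym)
  moreover have "openin (qpm_topology Y d) (Y - C)"
  proof (rule op)
    fix x assume "x \<in> Y - C"
    then obtain e where "e > 0" "qpm_ball Y d x e \<inter> C = {}"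
      using assms(3) by blast
    then show "\<exists>e>0. qpm_ball Y d x e \<subseteq> Y - C"
      by (auto simp: qpm_ball_def)
  qed auto
  ultimately show ?thesis
    using assms(2) by (simp add: closedin_def)
qed

lemma qpm_ball_preorder_dist:
  "qpm_ball Y (preorder_dist R) x 1 = {y \<in> Y. (x, y) \<in> R}"
  by (auto simp: qpm_ball_def preorder_dist_def)

lemma qpm_ball_symmetrization_preorder_dist:
  "qpm_ball Y (symmetrization (preorder_dist R)) x 1 = {y \<in> Y. indifferent R x y}"
  by (auto simp: qpm_ball_def symmetrization_def preorder_dist_def indifferent_def)

text \<open>If \<open>x\<close> is not below \<open>y\<close>, then nothing above \<open>x\<close>
  is below \<open>y\<close>, by transitivity; so the unit ball at \<open>x\<close> misses the lower
  contour set of \<open>y\<close>.\<close>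

lemma lower_continuous_preorder_dist:
  assumes "preorder_on Y R"
  shows "lower_continuous Y (qpm_topology Y (preorder_dist R)) R"
proof -
  have "trans R"
    using assms by (simp add: preorder_on_def)
  show ?thesis
    unfolding lower_continuous_def
  proof
    fix y
    show "closedin (qpm_topology Y (preorder_dist R)) {x \<in> Y. (x, y) \<in> R}"
    proof (rule closedin_qpm_topology)
      fix x assume "x \<in> Y - {x \<in> Y. (x, y) \<in> R}"
      then have "qpm_ball Y (preorder_dist R) x 1 \<inter> {x \<in> Y. (x, y) \<in> R} = {}"
        unfolding qpm_ball_preorder_dist using transD[OF \<open>trans R\<close>] by blast
      then show "\<exists>e>0. qpm_ball Y (preorder_dist R) x e \<inter> {x \<in> Y. (x, y) \<in> R} = {}"
        using zero_less_one by blast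
    qed (use assms quasi_pseudo_metric_preorder_dist in auto)
  qed
qed

lemma continuous_preorder_symmetrization:
  assumes "preorder_on Y R"
  shows "continuous_preorder Y (qpm_topology Y (symmetrization (preorder_dist R))) R"
proof -
  let ?d = "symmetrization (preorder_dist R)"
  have "trans R"
    using assms by (simp add: preorder_on_def)
  \<comment> \<open>Sets saturated under indifference are closed, and by transitivity both kinds of
    contour sets are saturated.\<close>
  have closed: "closedin (qpm_topology Y ?d) C"
    if "C \<subseteq> Y" and C: "\<And>x z. z \<in> C \<Longrightarrow> x \<in> Y \<Longrightarrow> indifferent R x z \<Longrightarrow> x \<in> C" for C
  proof (rule closedin_qpm_topology)
    fix x assume "x \<in> Y - C"
    then have "qpm_ball Y ?d x 1 \<inter> C = {}"
      unfolding qpm_ball_symmetrization_preorder_dist using C by blast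
    then show "\<exists>e>0. qpm_ball Y ?d x e \<inter> C = {}"
      using zero_less_one by blast
  qed (fact quasi_pseudo_metric_symmetrization[OF quasi_pseudo_metric_preorder_dist[OF assms]], fact)
  show ?thesis
    unfolding continuous_preorder_def
    by (intro ballI conjI closed) (use transD[OF \<open>trans R\<close>] in \<open>unfold indifferent_def, blast+\<close>)
qed

section \<open>The exponential cost of the first generations\<close>

text \<open>This is the negative of the utilitarian sum, so a lower cost is better.\<close>

definition exp_cost :: "nat \<Rightarrow> (nat \<Rightarrow> real) \<Rightarrow> real" where
  "exp_cost n x = (\<Sum>t<n. exp (- x t))"

lemma exp_cost_permute:
  assumes "\<pi> \<in> finite_perms"
  shows "eventually (\<lambda>n. exp_cost n (x \<circ> \<pi>) = exp_cost n x) sequentially"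
proof -
  obtain t0 where "bij \<pi>" and t0: "\<And>t. t > t0 \<Longrightarrow> \<pi> t = t"
    using assms by (auto simp: finite_perms_def)
  have "exp_cost n (x \<circ> \<pi>) = exp_cost n x" if "n > t0" for n
  proof -
    \<comment> \<open>Every index outside \<open>{..<n}\<close> is at least \<open>n > t0\<close>,
      hence fixed by \<open>\<pi>\<close>.\<close>
    have "\<pi> permutes {..<n}"
      using \<open>bij \<pi>\<close> t0 that by (auto simp: permutes_def bij_iff)
    from sum.permute[OF this, of "\<lambda>t. exp (- x t)"] show ?thesis
      by (simp add: exp_cost_def)
  qed
  then show ?thesis
    by (rule eventually_mono[OF eventually_gt_at_top[of t0]])
qed

lemma exp_cost_strict_mono:
  assumes "\<And>t. x t \<le> y t" "x \<noteq> y"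
  shows "eventually (\<lambda>n. exp_cost n y < exp_cost n x) sequentially"
proof -
  obtain t where "x t < y t"
    using assms by (metis ext order_le_less)
  then have "exp_cost n y < exp_cost n x" if "n > t" for n
    unfolding exp_cost_def using that assms(1) by (intro sum_strict_mono_ex1) auto
  then show ?thesis
    by (rule eventually_mono[OF eventually_gt_at_top[of t]])
qed

text \<open>Away from \<open>m\<close>, the graph of \<open>exp\<close> lies strictly above its
  tangent at the mean \<open>m\<close>; averaging the tangent values at \<open>a\<close> and
  \<open>b\<close> gives back \<open>exp m\<close>.\<close>

lemma exp_convex_strict:
  fixes a b s :: real
  assumes "0 < s" "s < 1" "a \<noteq> b"
  shows "exp (s * a + (1 - s) * b) < s * exp a + (1 - s) * exp b"
proof -
  define m where "m = s * a + (1 - s) * b"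
  have "a - m = (1 - s) * (a - b)" "b - m = s * (b - a)"
    by (simp_all add: m_def algebra_simps)
  then have "a \<noteq> m" "b \<noteq> m"
    using assms by auto
  have tangent: "exp m * (1 + (c - m)) < exp c" if "c \<noteq> m" for c
  proof -
    have "1 + (c - m) < exp (c - m)"
      using exp_minus_greater[of "m - c"] that by simp
    then have "exp m * (1 + (c - m)) < exp m * exp (c - m)"
      by simp
    then show ?thesis
      by (simp flip: exp_add)
  qed
  have "exp m = s * (exp m * (1 + (a - m))) + (1 - s) * (exp m * (1 + (b - m)))"
    by (simp add: m_def algebra_simps)
  also have "\<dots> < s * exp a + (1 - s) * exp b"
    using assms tangent[OF \<open>a \<noteq> m\<close>] tangent[OF \<open>b \<noteq> m\<close>] by (intro add_strict_mono) simp_all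
  finally show ?thesis
    by (simp add: m_def)
qed

text \<open>Convexity holds termwise, and one coordinate \<open>t\<close> where \<open>x\<close> and
  \<open>y\<close> differ makes the sum strict once \<open>n > t\<close>.\<close>

lemma exp_cost_convex_strict:
  fixes s :: real
  assumes "0 < s" "s < 1" "x \<noteq> y"
  shows "eventually (\<lambda>n. exp_cost n (\<lambda>t. s * x t + (1 - s) * y t)
           < s * exp_cost n x + (1 - s) * exp_cost n y) sequentially"
proof -
  obtain t where t: "x t \<noteq> y t"
    using assms by blast
  have strict: "exp (- (s * x i + (1 - s) * y i)) < s * exp (- x i) + (1 - s) * exp (- y i)"
    if "x i \<noteq> y i" for i
    using exp_convex_strict[of s "- x i" "- y i"] assms that by (simp add: algebra_simps)
  have weak: "exp (- (s * x i + (1 - s) * y i)) \<le> s * exp (- x i) + (1 - s) * exp (- y i)" for i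
  proof (cases "x i = y i")
    case True
    then show ?thesis by (simp add: algebra_simps)
  next
    case False
    then show ?thesis using strict by (simp add: less_imp_le)
  qed
  have "exp_cost n (\<lambda>t. s * x t + (1 - s) * y t) < s * exp_cost n x + (1 - s) * exp_cost n y"
    if "n > t" for n
    unfolding exp_cost_def sum_distrib_left sum.distrib[symmetric]
    using that t strict weak by (intro sum_strict_mono_ex1) auto
  then show ?thesis
    by (rule eventually_mono[OF eventually_gt_at_top[of t]])
qed

lemma linf_comp: "x \<in> linf \<Longrightarrow> x \<circ> \<pi> \<in> linf"
  unfolding linf_def by (auto intro: bounded_subset)

lemma linf_lincomb:
  assumes "x \<in> linf" "y \<in> linf"
  shows "(\<lambda>n. a * x n + b * y n) \<in> linf"
proof -
  have "bounded (range (\<lambda>n. a *\<^sub>R x n + b *\<^sub>R y n))"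
    using assms unfolding linf_def
    by (intro bounded_plus_comp bounded_scaleR_comp) simp_all
  then show ?thesis
    by (simp add: linf_def)
qed

section \<open>The social welfare order\<close>

theorem theorem20:
  shows "\<exists>R :: (nat \<Rightarrow> real) rel.
    ethical_social_welfare_order R \<and>
    anonymity R \<and>
    strong_monotonicity R \<and>
    strong_distributive_fairness_semiconvexity R \<and>
    continuous_preorder linf (qpm_topology linf (symmetrization (preorder_dist R))) R \<and>
    lower_continuous linf (qpm_topology linf (preorder_dist R)) R"
proof -
  obtain U :: "nat filter" where "U \<noteq> bot" and "U \<le> sequentially"
    and ultra: "\<And>P. eventually P U \<or> eventually (\<lambda>n. \<not> P n) U"
    using ultrafilter_exists[OF sequentially_bot] by blast
  define R where
    "R = {(x, y). x \<in> linf \<and> y \<in> linf \<and> eventually (\<lambda>n. exp_cost n y \<le> exp_cost n x) U}"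
  have seq: "eventually P U" if "eventually P sequentially" for P
    using that \<open>U \<le> sequentially\<close> by (simp add: filter_leD)
  \<comment> \<open>A strict cost inequality for all large \<open>n\<close> passes to
    \<open>U\<close>, and since \<open>U\<close> is proper the reverse weak inequality cannot hold
    along it.\<close>
  have strictI: "strictly_below R x y"
    if "x \<in> linf" "y \<in> linf" and lt: "eventually (\<lambda>n. exp_cost n y < exp_cost n x) sequentially"
    for x y
  proof -
    have "\<not> eventually (\<lambda>n. exp_cost n x \<le> exp_cost n y) U"
    proof
      assume "eventually (\<lambda>n. exp_cost n x \<le> exp_cost n y) U"
      with seq[OF lt] have "eventually (\<lambda>_. False) U"
        by eventually_elim simp
      with \<open>U \<noteq> bot\<close> show False
        by (simp add: trivial_limit_def)
    qed
    moreover have "eventually (\<lambda>n. exp_cost n y \<le> exp_cost n x) U"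
      using seq[OF lt] by eventually_elim simp
    ultimately show ?thesis
      using that by (simp add: strictly_below_def R_def)
  qed
  have "trans R"
    unfolding R_def trans_def by (auto elim: eventually_elim2)
  then have pre: "preorder_on linf R"
    by (auto simp: preorder_on_def R_def refl_on_def)
  have total: "total_on linf R"
    unfolding total_on_def
  proof (intro ballI impI)
    fix x y assume "x \<in> linf" "y \<in> linf"
    then show "(x, y) \<in> R \<or> (y, x) \<in> R"
      using ultra[of "\<lambda>n. exp_cost n y \<le> exp_cost n x"]
        eventually_mono[of "\<lambda>n. \<not> exp_cost n y \<le> exp_cost n x" U
          "\<lambda>n. exp_cost n x \<le> exp_cost n y"]
      by (auto simp: R_def)
  qed
  have anon: "anonymity R"
    unfolding anonymity_def
  proof (intro ballI)
    fix x \<pi> assume "x \<in> linf" and \<pi>: "\<pi> \<in> finite_perms"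
    moreover have "eventually (\<lambda>n. exp_cost n (x \<circ> \<pi>) \<le> exp_cost n x) U"
      "eventually (\<lambda>n. exp_cost n x \<le> exp_cost n (x \<circ> \<pi>)) U"
      using seq[OF exp_cost_permute[OF \<pi>, of x]] by (auto elim: eventually_mono)
    ultimately show "indifferent R x (x \<circ> \<pi>)"
      by (simp add: indifferent_def R_def linf_comp)
  qed
  have mono: "strong_monotonicity R"
    unfolding strong_monotonicity_def using exp_cost_strict_mono strictI by blast
  have "strong_distributive_fairness_semiconvexity R"
    unfolding strong_distributive_fairness_semiconvexity_def
  proof (intro ballI impI)
    fix x \<pi> and s :: real
    assume x: "x \<in> linf" and \<pi>: "\<pi> \<in> finite_perms" and "x \<noteq> x \<circ> \<pi>" and s: "s \<in> {0<..<1}"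
    let ?y = "\<lambda>n. s * x n + (1 - s) * (x \<circ> \<pi>) n"
    have "eventually (\<lambda>n. exp_cost n ?y < s * exp_cost n x + (1 - s) * exp_cost n (x \<circ> \<pi>))
        sequentially"
      using exp_cost_convex_strict[of s x "x \<circ> \<pi>"] s \<open>x \<noteq> x \<circ> \<pi>\<close> by simp
    \<comment> \<open>For large \<open>n\<close> both costs on the right coincide, so their weighted
      mean is the cost of \<open>x\<close> and also that of \<open>x \<circ> \<pi>\<close>.\<close>
    with exp_cost_permute[OF \<pi>, of x]
    have "eventually (\<lambda>n. exp_cost n ?y < exp_cost n x \<and> exp_cost n ?y < exp_cost n (x \<circ> \<pi>))
        sequentially"
      by eventually_elim (simp add: algebra_simps)
    then have "eventually (\<lambda>n. exp_cost n ?y < exp_cost n x) sequentially"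
      "eventually (\<lambda>n. exp_cost n ?y < exp_cost n (x \<circ> \<pi>)) sequentially"
      by (simp_all add: eventually_conj_iff)
    then show "strictly_below R x ?y \<and> strictly_below R (x \<circ> \<pi>) ?y"
      using x by (intro conjI strictI linf_lincomb linf_comp)
  qed
  with pre total anon mono show ?thesis
    unfolding ethical_social_welfare_order_def
    using continuous_preorder_symmetrization lower_continuous_preorder_dist by blast
qed

end
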